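(* Let $k\ge2$, $a>0$ and $D\ge1$, and suppose that for each $n$, $\mathcal{H}=\mathcal{H}_n$ is a $k$-uniform hypergraph satisfying $v(\mathcal{H})\le Dn$, $e(\mathcal{H})\ge an^2$ and $\Delta_2(\mathcal{H})\le D$. Let $X=e(\mathcal{H}_p)$, $\mu=\mathbb{E}X$, $\Lambda=\mu(1+np^{k-1})$ and $\varphi(x)=(1+x)\log(1+x)-x$. Given $\alpha\in(0,1)$, there are $n_0>0$ (depending only on $k,a,D$) and $\beta,c>0$ (depending only on $\alpha,k,a,D$) such that for all $n\ge n_0$, $\alpha n^{-1/(k-1)}\le p\le1-\alpha$ and $\min\{\sqrt{\Lambda},\sqrt{\mathrm{Var}\,X}\}\le t\le\beta\mu$ we have \[ \Pr(X\ge\mu+t)\ge\exp\bigl(-c\varphi(t/\mu)\mu^2/\Lambda\bigr)\ge\exp\bigl(-ct^2/\Lambda\bigr). \]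
   Context: $V_p(\mathcal{H})$ is the random subset of $V(\mathcal{H})$ containing each vertex independently with probability $p$, and $\mathcal{H}_p=\mathcal{H}[V_p(\mathcal{H})]$. $\Delta_2(\mathcal{H})$ is the maximum number of edges containing a given pair of vertices. *)

theory Defs
  imports "HOL-Probability.Probability"
begin

record 'a hypergraph =
  vertices :: "'a set"
  edges :: "'a set set"

definition uniform_hypergraph :: "nat \<Rightarrow> 'a hypergraph \<Rightarrow> bool" where
  "uniform_hypergraph k H \<longleftrightarrow>
     finite (vertices H) \<and> (\<forall>e\<in>edges H. e \<subseteq> vertices H \<and> card e = k)"

definition num_vertices :: "'a hypergraph \<Rightarrow> nat" where
  "num_vertices H = card (vertices H)"

definition num_edges :: "'a hypergraph \<Rightarrow> nat" where
  "num_edges H = card (edges H)"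

definition codegree :: "'a hypergraph \<Rightarrow> 'a \<Rightarrow> 'a \<Rightarrow> nat" where
  "codegree H u v = card {e \<in> edges H. {u, v} \<subseteq> e}"

text \<open>\<open>\<Delta>\<^sub>2(H)\<close>. Pairs consist of distinct vertices; the inserted \<open>0\<close> only matters
  when there are fewer than two vertices.\<close>

definition max_codegree :: "'a hypergraph \<Rightarrow> nat" where
  "max_codegree H =
     Max (insert 0 {codegree H u v | u v. u \<in> vertices H \<and> v \<in> vertices H \<and> u \<noteq> v})"

definition induced :: "'a hypergraph \<Rightarrow> 'a set \<Rightarrow> 'a hypergraph" where
  "induced H U = \<lparr>vertices = U, edges = {e \<in> edges H. e \<subseteq> U}\<rparr>"

definition random_subset :: "'a set \<Rightarrow> real \<Rightarrow> 'a set pmf" where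
  "random_subset V p =
     map_pmf (\<lambda>b. {v \<in> V. b v}) (Pi_pmf V False (\<lambda>_. bernoulli_pmf p))"

definition random_induced :: "'a hypergraph \<Rightarrow> real \<Rightarrow> 'a hypergraph pmf" where
  "random_induced H p = map_pmf (induced H) (random_subset (vertices H) p)"

definition phi :: "real \<Rightarrow> real" where
  "phi x = (1 + x) * ln (1 + x) - x"

end

theory Submission
  imports Defs
begin

text \<open>
  Let \<open>A\<close> be the event \<open>X \<ge> \<mu> + t\<close>. Raise the vertex probability to \<open>q = p (1 + K t / \<mu>)\<close> for a
  large constant \<open>K\<close>. Then the mean of \<open>X\<close> grows by at least \<open>2 K t\<close>, while its variance stays
  \<open>O(\<Lambda>)\<close>; since \<open>Var X\<close>, and hence \<open>t\<^sup>2\<close>, is at least a constant times \<open>\<Lambda>\<close>, Chebyshev's inequality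
  gives \<open>A\<close> probability at least \<open>1/2\<close> under \<open>q\<close>. By Cauchy--Schwarz, returning to \<open>p\<close> costs at most a
  factor \<open>exp (v(H) (q - p)\<^sup>2 / (p (1 - p)))\<close>. Because \<open>n p\<^sup>k\<^sup>-\<^sup>1\<close> is bounded below, \<open>\<Lambda>\<close> is of order
  \<open>\<mu> n p\<^sup>k\<^sup>-\<^sup>1\<close>, and so the exponent is \<open>O(t\<^sup>2 / \<Lambda>)\<close>, which also absorbs the constant \<open>1/4\<close>.
  Finally \<open>\<phi>(x)\<close> lies between \<open>x\<^sup>2 / 4\<close> and \<open>x\<^sup>2\<close> on \<open>[0, 1]\<close>.
\<close>

section \<open>Binomial random subsets\<close>

lemma finite_set_random_subset:
  assumes "finite V"
  shows "finite (set_pmf (random_subset V q))"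
proof -
  have "set_pmf (random_subset V q) \<subseteq> Pow V"
    by (auto simp: random_subset_def)
  then show ?thesis using assms by (meson finite_Pow_iff finite_subset)
qed

lemma prob_random_subset_superset:
  fixes q :: real
  assumes V: "finite V" and S: "S \<subseteq> V" and q: "0 \<le> q" "q \<le> 1"
  shows "measure_pmf.prob (random_subset V q) {U. S \<subseteq> U} = q ^ card S"
proof -
  let ?B = "\<lambda>v. if v \<in> S then {True} else UNIV"
  have "measure_pmf.prob (random_subset V q) {U. S \<subseteq> U} =
      measure_pmf.prob (Pi_pmf V False (\<lambda>_. bernoulli_pmf q)) (Pi V ?B)"
    unfolding random_subset_def measure_map_pmf
    using S by (intro arg_cong[where f = "measure _"]) (auto simp: Pi_iff split: if_split_asm)
  also have "\<dots> = (\<Prod>v\<in>V. measure_pmf.prob (bernoulli_pmf q) (?B v))"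
    by (rule measure_Pi_pmf_Pi[OF V])
  also have "\<dots> = (\<Prod>v\<in>V. if v \<in> S then q else 1)"
    using q by (intro prod.cong) (auto simp: measure_pmf_single)
  also have "\<dots> = q ^ card S"
    using V S by (simp add: prod.If_cases Int_absorb1)
  finally show ?thesis .
qed

lemma pmf_random_subset:
  fixes q :: real
  assumes V: "finite V" and U: "U \<subseteq> V" and q: "0 \<le> q" "q \<le> 1"
  shows "pmf (random_subset V q) U = q ^ card U * (1 - q) ^ card (V - U)"
proof -
  let ?P = "Pi_pmf V False (\<lambda>_. bernoulli_pmf q)"
  have "pmf (random_subset V q) U = measure_pmf.prob ?P {b. {v \<in> V. b v} = U}"
    unfolding random_subset_def pmf_map by (simp add: vimage_def)
  \<comment> \<open>\<open>Pi_pmf\<close> is supported on functions with the default value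
    \<open>False\<close> off \<open>V\<close>. Among these only the indicator of \<open>U\<close>
    produces \<open>U\<close>, so the two events agree almost surely, though not as sets.\<close>
  also have "\<dots> = measure_pmf.prob ?P {\<lambda>v. v \<in> U}"
  proof (rule measure_pmf.finite_measure_eq_AE)
    show "AE b in measure_pmf ?P. (b \<in> {b. {v \<in> V. b v} = U}) = (b \<in> {\<lambda>v. v \<in> U})"
      using set_Pi_pmf_subset[OF V, of False "\<lambda>_. bernoulli_pmf q"] U
      by (fastforce simp: AE_measure_pmf_iff fun_eq_iff)
  qed auto
  also have "\<dots> = (\<Prod>v\<in>V. pmf (bernoulli_pmf q) (v \<in> U))"
    using V U by (auto simp: measure_pmf_single intro!: pmf_Pi')
  also have "\<dots> = (\<Prod>v\<in>V. if v \<in> U then q else 1 - q)"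
    using q by (intro prod.cong) auto
  also have "\<dots> = q ^ card U * (1 - q) ^ card (V - U)"
    using V U by (simp add: prod.If_cases Int_absorb1 Diff_eq)
  finally show ?thesis .
qed

text \<open>Expand the product of \<open>x + y\<close> over \<open>V\<close>: the set
  \<open>U\<close> records the factors from which \<open>x\<close> is chosen.\<close>

lemma sum_Pow_binomial_weights:
  fixes x y :: "'b :: comm_semiring_1"
  assumes "finite V"
  shows "(\<Sum>U\<in>Pow V. x ^ card U * y ^ card (V - U)) = (x + y) ^ card V"
  using prod_add[OF assms, of "\<lambda>_. x" "\<lambda>_. y"] by simp

text \<open>Cauchy--Schwarz against the density of the \<open>q\<close>-random set with respect to the
  \<open>p\<close>-random one, whose second moment is \<open>(q\<^sup>2 / p + (1 - q)\<^sup>2 / (1 - p))\<close> to the power \<open>card V\<close>.\<close>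

lemma prob_random_subset_change:
  fixes p q :: real
  assumes V: "finite V" and p: "0 < p" "p < 1" and q: "0 \<le> q" "q \<le> 1"
  shows "(measure_pmf.prob (random_subset V q) A)\<^sup>2
    \<le> measure_pmf.prob (random_subset V p) A * exp (card V * (q - p)\<^sup>2 / (p * (1 - p)))"
proof -
  let ?f = "\<lambda>r. pmf (random_subset V r)"
  let ?A = "A \<inter> Pow V"
  have fin: "finite ?A" using V by auto
  have prob_eq: "measure_pmf.prob (random_subset V r) A = sum (?f r) ?A" for r
  proof -
    have "measure_pmf.prob (random_subset V r) A = measure_pmf.prob (random_subset V r) ?A"
      by (rule measure_pmf.finite_measure_eq_AE)
         (auto simp: AE_measure_pmf_iff random_subset_def)
    then show ?thesis by (simp add: measure_measure_pmf_finite[OF fin])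
  qed
  have pos: "?f p U > 0" if "U \<subseteq> V" for U
    using pmf_random_subset[OF V that, of p] p by simp
  \<comment> \<open>The weight \<open>sqrt (?f p U)\<close> is chosen so that its squares sum to the
    \<open>p\<close>-probability of the event; dividing by it is legitimate since
    \<open>0 < p < 1\<close> gives every subset positive mass.\<close>
  have "(sum (?f q) ?A)\<^sup>2 = (\<Sum>U\<in>?A. sqrt (?f p U) * (?f q U / sqrt (?f p U)))\<^sup>2"
    using pos by (intro arg_cong[where f = "\<lambda>x. x\<^sup>2"] sum.cong) (auto simp: less_imp_neq[symmetric])
  also have "\<dots> \<le> (\<Sum>U\<in>?A. (sqrt (?f p U))\<^sup>2) * (\<Sum>U\<in>?A. (?f q U / sqrt (?f p U))\<^sup>2)"
    by (rule Cauchy_Schwarz_ineq_sum)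
  also have "\<dots> = sum (?f p) ?A * (\<Sum>U\<in>?A. (?f q U)\<^sup>2 / ?f p U)"
    by (simp add: power_divide)
  \<comment> \<open>Only on the full power set does the sum factor over the vertices.\<close>
  also have "(\<Sum>U\<in>?A. (?f q U)\<^sup>2 / ?f p U) \<le> (\<Sum>U\<in>Pow V. (?f q U)\<^sup>2 / ?f p U)"
    using V by (intro sum_mono2) auto
  also have "\<dots> = (\<Sum>U\<in>Pow V. (q\<^sup>2 / p) ^ card U * ((1 - q)\<^sup>2 / (1 - p)) ^ card (V - U))"
  proof (rule sum.cong[OF refl])
    fix U assume "U \<in> Pow V"
    then have "U \<subseteq> V" by simp
    then show "(?f q U)\<^sup>2 / ?f p U
        = (q\<^sup>2 / p) ^ card U * ((1 - q)\<^sup>2 / (1 - p)) ^ card (V - U)"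
      using p q by (simp add: pmf_random_subset[OF V] power_mult_distrib power_divide
          power_even_eq[symmetric] mult.commute flip: power_mult)
  qed
  also have "\<dots> = (q\<^sup>2 / p + (1 - q)\<^sup>2 / (1 - p)) ^ card V"
    by (rule sum_Pow_binomial_weights[OF V])
  \<comment> \<open>This is one plus the chi-square divergence between the two Bernoulli
    laws.\<close>
  also have "q\<^sup>2 / p + (1 - q)\<^sup>2 / (1 - p) = 1 + (q - p)\<^sup>2 / (p * (1 - p))"
    using p by (simp add: field_simps power2_eq_square)
  also have "\<dots> ^ card V \<le> exp ((q - p)\<^sup>2 / (p * (1 - p))) ^ card V"
    using p by (intro power_mono exp_ge_add_one_self) simp_all
  also have "\<dots> = exp (card V * (q - p)\<^sup>2 / (p * (1 - p)))"
    by (simp add: exp_of_nat_mult[symmetric])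
  finally show ?thesis
    unfolding prob_eq by (simp add: mult_left_mono sum_nonneg)
qed

section \<open>Moments of the number of induced edges\<close>

context
  fixes k :: nat and H :: "'a hypergraph"
  assumes uniform: "uniform_hypergraph k H"
begin

lemma finite_vertices: "finite (vertices H)"
  and edge_subset: "e \<in> edges H \<Longrightarrow> e \<subseteq> vertices H"
  and card_edge: "e \<in> edges H \<Longrightarrow> card e = k"
  using uniform by (auto simp: uniform_hypergraph_def)

lemma finite_edge: "e \<in> edges H \<Longrightarrow> finite e"
  using edge_subset finite_vertices finite_subset by blast

lemma finite_edges: "finite (edges H)"
  using finite_subset[of "edges H" "Pow (vertices H)"] edge_subset finite_vertices by auto

lemma num_edges_induced:
  "real (num_edges (induced H U)) = (\<Sum>e\<in>edges H. indicator {U. e \<subseteq> U} U)"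
  using finite_edges
  by (simp add: num_edges_def induced_def indicator_def sum.If_cases Collect_conj_eq)

lemma integrable_random_induced:
  "integrable (measure_pmf (random_induced H q)) (f :: _ \<Rightarrow> real)"
  unfolding random_induced_def
  by (rule integrable_measure_pmf_finite) (simp add: finite_set_random_subset finite_vertices)

lemma integrable_random_subset:
  "integrable (measure_pmf (random_subset (vertices H) q)) (f :: _ \<Rightarrow> real)"
  by (rule integrable_measure_pmf_finite) (simp add: finite_set_random_subset finite_vertices)

lemma expectation_num_edges:
  fixes q :: real
  assumes q: "0 \<le> q" "q \<le> 1"
  shows "measure_pmf.expectation (random_induced H q) (\<lambda>G. real (num_edges G))
    = num_edges H * q ^ k"
proof -
  have "measure_pmf.expectation (random_induced H q) (\<lambda>G. real (num_edges G))
    = (\<Sum>e\<in>edges H. measure_pmf.prob (random_subset (vertices H) q) {U. e \<subseteq> U})"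
    unfolding random_induced_def
    by (simp add: num_edges_induced integrable_random_subset)
  also have "\<dots> = (\<Sum>e\<in>edges H. q ^ k)"
    by (intro sum.cong refl)
       (simp add: prob_random_subset_superset finite_vertices edge_subset q card_edge)
  finally show ?thesis by (simp add: num_edges_def)
qed

text \<open>The square of the edge count sums the indicators of
  \<open>e \<union> f \<subseteq> U\<close> over ordered pairs. Disjoint pairs may stay in the sum:
  their union has \<open>2 * k\<close> elements, so their terms vanish.\<close>

lemma variance_num_edges:
  fixes q :: real
  assumes q: "0 \<le> q" "q \<le> 1"
  shows "measure_pmf.variance (random_induced H q) (\<lambda>G. real (num_edges G))
    = (\<Sum>e\<in>edges H. \<Sum>f\<in>edges H. q ^ card (e \<union> f) - q ^ (2 * k))"
proof -
  let ?X = "\<lambda>G::'a hypergraph. real (num_edges G)"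
  have sq: "(?X (induced H U))\<^sup>2
      = (\<Sum>e\<in>edges H. \<Sum>f\<in>edges H. indicator {U. e \<union> f \<subseteq> U} U)" for U
    unfolding num_edges_induced power2_eq_square sum_product
    by (intro sum.cong refl) (auto simp: indicator_def)
  have "measure_pmf.expectation (random_induced H q) (\<lambda>G. (?X G)\<^sup>2)
    = (\<Sum>e\<in>edges H. \<Sum>f\<in>edges H.
        measure_pmf.prob (random_subset (vertices H) q) {U. e \<union> f \<subseteq> U})"
    unfolding random_induced_def
    by (simp add: sq integrable_random_subset)
  also have "\<dots> = (\<Sum>e\<in>edges H. \<Sum>f\<in>edges H. q ^ card (e \<union> f))"
    by (intro sum.cong refl prob_random_subset_superset finite_vertices q)
       (simp add: edge_subset)
  finally have "measure_pmf.variance (random_induced H q) ?X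
    = (\<Sum>e\<in>edges H. \<Sum>f\<in>edges H. q ^ card (e \<union> f)) - (num_edges H * q ^ k)\<^sup>2"
    by (subst measure_pmf.variance_eq)
       (simp_all only: integrable_random_induced expectation_num_edges q)
  also have "\<dots> = (\<Sum>e\<in>edges H. \<Sum>f\<in>edges H. q ^ card (e \<union> f) - q ^ (2 * k))"
    by (simp add: sum_subtractf num_edges_def power_mult_distrib power_mult
        power2_eq_square power_mult[of q k 2, unfolded mult.commute[of k]])
  finally show ?thesis .
qed

section \<open>Degrees, codegrees and intersecting pairs of edges\<close>

lemma sum_degrees:
  "(\<Sum>v\<in>vertices H. card {e \<in> edges H. v \<in> e}) = k * num_edges H"
proof -
  have "card {v \<in> vertices H. v \<in> e} = k" if "e \<in> edges H" for e
    using edge_subset[OF that] card_edge[OF that] by (simp add: Collect_conj_eq Int_absorb1)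
  then have "(\<Sum>v\<in>vertices H. card {e \<in> edges H. v \<in> e}) = (\<Sum>e\<in>edges H. k)"
    using finite_vertices finite_edges by (intro sum_multicount_gen) auto
  then show ?thesis by (simp add: num_edges_def)
qed

lemma codegree_le_max:
  assumes "u \<in> vertices H" "v \<in> vertices H" "u \<noteq> v"
  shows "codegree H u v \<le> max_codegree H"
  unfolding max_codegree_def
proof (rule Max_ge)
  have "{codegree H u v |u v. u \<in> vertices H \<and> v \<in> vertices H \<and> u \<noteq> v}
      \<subseteq> (\<lambda>(u, v). codegree H u v) ` (vertices H \<times> vertices H)" by auto
  then show "finite (insert 0 {codegree H u v |u v. u \<in> vertices H \<and> v \<in> vertices H \<and> u \<noteq> v})"
    using finite_vertices finite_subset by fastforce
qed (use assms in auto)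

text \<open>Since \<open>k \<ge> 2\<close>, every edge through \<open>v\<close> contains a second
  vertex \<open>u\<close>, and each \<open>u\<close> accounts for at most
  \<open>max_codegree H\<close> of these edges.\<close>

lemma degree_le:
  assumes k: "k \<ge> 2" and v: "v \<in> vertices H"
  shows "card {e \<in> edges H. v \<in> e} \<le> num_vertices H * max_codegree H"
proof -
  have "{e \<in> edges H. v \<in> e} \<subseteq> (\<Union>u\<in>vertices H - {v}. {e \<in> edges H. {u, v} \<subseteq> e})"
  proof
    fix e assume "e \<in> {e \<in> edges H. v \<in> e}"
    then have e: "e \<in> edges H" "v \<in> e" by auto
    have "\<not> e \<subseteq> {v}"
      using card_edge[OF e(1)] k card_mono[of "{v}" e] by auto
    then show "e \<in> (\<Union>u\<in>vertices H - {v}. {e \<in> edges H. {u, v} \<subseteq> e})"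
      using e edge_subset[OF e(1)] by auto
  qed
  then have "card {e \<in> edges H. v \<in> e}
      \<le> card (\<Union>u\<in>vertices H - {v}. {e \<in> edges H. {u, v} \<subseteq> e})"
    using finite_vertices finite_edges by (intro card_mono) auto
  also have "\<dots> \<le> (\<Sum>u\<in>vertices H - {v}. codegree H u v)"
    unfolding codegree_def using finite_vertices by (intro card_UN_le) simp
  also have "\<dots> \<le> (\<Sum>u\<in>vertices H. max_codegree H)"
    using finite_vertices v codegree_le_max by (intro sum_le_included[where i = id]) auto
  finally show ?thesis by (simp add: num_vertices_def)
qed

text \<open>Each such \<open>f\<close> contains an ordered pair of distinct vertices of
  \<open>e\<close>, and there are at most \<open>k\<^sup>2\<close> such pairs.\<close>

lemma card_edges_sharing_two:
  assumes e: "e \<in> edges H"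
  shows "card {f \<in> edges H. 2 \<le> card (e \<inter> f)} \<le> k\<^sup>2 * max_codegree H"
proof -
  let ?P = "e \<times> e \<inter> {(u, v). u \<noteq> v}"
  have fin: "finite ?P" using finite_edge[OF e] by auto
  have "{f \<in> edges H. 2 \<le> card (e \<inter> f)} \<subseteq> (\<Union>(u, v)\<in>?P. {f \<in> edges H. {u, v} \<subseteq> f})"
    by (fastforce simp: numeral_2_eq_2 card_le_Suc_iff)
  then have "card {f \<in> edges H. 2 \<le> card (e \<inter> f)}
      \<le> card (\<Union>(u, v)\<in>?P. {f \<in> edges H. {u, v} \<subseteq> f})"
    using fin finite_edges by (intro card_mono) auto
  also have "\<dots> \<le> (\<Sum>x\<in>?P. card (case x of (u, v) \<Rightarrow> {f \<in> edges H. {u, v} \<subseteq> f}))"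
    using fin by (rule card_UN_le)
  also have "\<dots> \<le> (\<Sum>x\<in>?P. max_codegree H)"
    using edge_subset[OF e] codegree_le_max
    by (intro sum_mono) (auto simp: codegree_def split: prod.split)
  also have "\<dots> = card ?P * max_codegree H" by simp
  also have "card ?P \<le> card (e \<times> e)"
    using finite_edge[OF e] by (intro card_mono) auto
  finally show ?thesis
    by (simp add: card_edge[OF e] card_cartesian_product power2_eq_square mult_le_mono1)
qed

text \<open>Both sides count triples \<open>(v, e, f)\<close> with
  \<open>v \<in> e \<inter> f\<close>.\<close>

lemma sum_degrees_squared:
  "(\<Sum>v\<in>vertices H. (card {e \<in> edges H. v \<in> e})\<^sup>2)
    = (\<Sum>e\<in>edges H. \<Sum>f\<in>edges H. card (e \<inter> f))"
proof -
  have "(\<Sum>v\<in>vertices H. (card {e \<in> edges H. v \<in> e})\<^sup>2)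
      = (\<Sum>v\<in>vertices H. card {x \<in> edges H \<times> edges H. v \<in> fst x \<inter> snd x})"
  proof (rule sum.cong[OF refl])
    fix v
    have "{x \<in> edges H \<times> edges H. v \<in> fst x \<inter> snd x}
        = {e \<in> edges H. v \<in> e} \<times> {e \<in> edges H. v \<in> e}" by auto
    then show "(card {e \<in> edges H. v \<in> e})\<^sup>2 = card {x \<in> edges H \<times> edges H. v \<in> fst x \<inter> snd x}"
      by (simp only: card_cartesian_product power2_eq_square)
  qed
  also have "\<dots> = (\<Sum>x\<in>edges H \<times> edges H. card (fst x \<inter> snd x))"
  proof (rule sum_multicount_gen)
    show "\<forall>x\<in>edges H \<times> edges H. card {v \<in> vertices H. v \<in> fst x \<inter> snd x} = card (fst x \<inter> snd x)"
      using edge_subset by (auto intro!: arg_cong[where f = card])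
  qed (use finite_vertices finite_edges in auto)
  finally show ?thesis by (simp add: sum.cartesian_product split_def)
qed

lemma card_Un_edges:
  assumes "e \<in> edges H" "f \<in> edges H"
  shows "card (e \<union> f) + card (e \<inter> f) = 2 * k"
  using card_Un_Int[OF finite_edge finite_edge, OF assms] card_edge assms by simp

section \<open>Upper and lower bounds for the variance\<close>

text \<open>The first summand covers pairs of edges meeting in one vertex, counted through the
  squared degrees; the second covers pairs sharing at least two vertices, which are few because
  codegrees are bounded.\<close>

lemma variance_num_edges_le:
  fixes q :: real
  assumes k: "k \<ge> 2" and q: "0 \<le> q" "q \<le> 1"
  shows "measure_pmf.variance (random_induced H q) (\<lambda>G. real (num_edges G))
    \<le> real (num_vertices H) ^ 3 * real (max_codegree H) ^ 2 * q ^ (2 * k - 1)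
      + real (num_edges H) * real (k\<^sup>2 * max_codegree H) * q ^ k"
proof -
  \<comment> \<open>The weight \<open>card (e \<inter> f)\<close> is 1 for pairs meeting once and
    turns the sum over pairs into a sum of squared degrees.\<close>
  have term_le: "q ^ card (e \<union> f) - q ^ (2 * k)
      \<le> real (card (e \<inter> f)) * q ^ (2 * k - 1) + indicator {f. 2 \<le> card (e \<inter> f)} f * q ^ k"
    if "e \<in> edges H" "f \<in> edges H" for e f
  proof -
    note un = card_Un_edges[OF that]
    have inter: "card (e \<inter> f) \<le> k"
      using card_mono[OF finite_edge[OF that(1)], of "e \<inter> f"] card_edge[OF that(1)] by simp
    consider "card (e \<inter> f) = 0" | "card (e \<inter> f) = 1" | "2 \<le> card (e \<inter> f)" by linarith
    then show ?thesis
    proof cases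
      case 1
      then show ?thesis using un q by simp
    next
      case 2
      then have "card (e \<union> f) = 2 * k - 1" using un by simp
      then show ?thesis using 2 q by simp
    next
      case 3
      have "q ^ card (e \<union> f) \<le> q ^ k"
        using un inter q by (intro power_decreasing) auto
      moreover have "0 \<le> q ^ (2 * k)" "0 \<le> real (card (e \<inter> f)) * q ^ (2 * k - 1)"
        using q by simp_all
      moreover have "indicator {f. 2 \<le> card (e \<inter> f)} f * q ^ k = q ^ k" using 3 by simp
      ultimately show ?thesis by linarith
    qed
  qed
  have "(\<Sum>e\<in>edges H. \<Sum>f\<in>edges H. card (e \<inter> f))
      \<le> (\<Sum>v\<in>vertices H. (num_vertices H * max_codegree H)\<^sup>2)"
    unfolding sum_degrees_squared[symmetric] using degree_le[OF k] by (intro sum_mono power_mono) auto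
  also have "\<dots> = num_vertices H ^ 3 * max_codegree H ^ 2"
    by (simp add: num_vertices_def power_mult_distrib power2_eq_square power3_eq_cube)
  finally have one: "(\<Sum>e\<in>edges H. \<Sum>f\<in>edges H. real (card (e \<inter> f)))
      \<le> real (num_vertices H) ^ 3 * real (max_codegree H) ^ 2"
    by (simp flip: of_nat_sum of_nat_power of_nat_mult)
  have "(\<Sum>f\<in>edges H. indicator {f. 2 \<le> card (e \<inter> f)} f) \<le> real (k\<^sup>2 * max_codegree H)"
    if "e \<in> edges H" for e
  proof -
    have "(\<Sum>f\<in>edges H. indicator {f. 2 \<le> card (e \<inter> f)} f)
        = real (card {f \<in> edges H. 2 \<le> card (e \<inter> f)})"
      using finite_edges by (simp add: indicator_def sum.If_cases Collect_conj_eq)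
    then show ?thesis using card_edges_sharing_two[OF that] by (simp only: of_nat_le_iff)
  qed
  then have two: "(\<Sum>e\<in>edges H. \<Sum>f\<in>edges H. indicator {f. 2 \<le> card (e \<inter> f)} f)
      \<le> real (num_edges H) * real (k\<^sup>2 * max_codegree H)"
    unfolding num_edges_def by (rule sum_bounded_above)
  have "measure_pmf.variance (random_induced H q) (\<lambda>G. real (num_edges G))
      \<le> (\<Sum>e\<in>edges H. \<Sum>f\<in>edges H.
          real (card (e \<inter> f)) * q ^ (2 * k - 1) + indicator {f. 2 \<le> card (e \<inter> f)} f * q ^ k)"
    unfolding variance_num_edges[OF q] by (intro sum_mono term_le)
  also have "\<dots> = (\<Sum>e\<in>edges H. \<Sum>f\<in>edges H. real (card (e \<inter> f))) * q ^ (2 * k - 1)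
      + (\<Sum>e\<in>edges H. \<Sum>f\<in>edges H. indicator {f. 2 \<le> card (e \<inter> f)} f) * q ^ k"
    by (simp add: sum.distrib sum_distrib_right)
  also have "\<dots> \<le> (real (num_vertices H) ^ 3 * real (max_codegree H) ^ 2) * q ^ (2 * k - 1)
      + (real (num_edges H) * real (k\<^sup>2 * max_codegree H)) * q ^ k"
    using one two q by (intro add_mono mult_right_mono) simp_all
  finally show ?thesis .
qed

text \<open>Cauchy--Schwarz for the degrees, which sum to \<open>k * num_edges H\<close>, bounds the
  total of \<open>card (e \<inter> f)\<close> from below. Disjoint pairs add nothing to the variance
  and meeting pairs add at least \<open>(1 - p) * p ^ (2 * k - 1)\<close>, so the two sums compare
  term by term.\<close>

lemma variance_num_edges_ge:
  fixes p :: real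
  assumes k: "k > 0" and p: "0 \<le> p" "p \<le> 1"
  shows "(1 - p) * p ^ (2 * k - 1) * (k * real (num_edges H) ^ 2)
    \<le> num_vertices H * measure_pmf.variance (random_induced H p) (\<lambda>G. real (num_edges G))"
proof -
  let ?Var = "measure_pmf.variance (random_induced H p) (\<lambda>G. real (num_edges G))"
  let ?deg = "\<lambda>v. card {e \<in> edges H. v \<in> e}"
  let ?w = "(1 - p) * p ^ (2 * k - 1)"
  have "(real (k * num_edges H))\<^sup>2 = (\<Sum>v\<in>vertices H. real (?deg v))\<^sup>2"
    by (simp only: sum_degrees[symmetric] of_nat_sum)
  also have "\<dots> \<le> num_vertices H * (\<Sum>v\<in>vertices H. (real (?deg v))\<^sup>2)"
    unfolding num_vertices_def
    by (rule sum_squared_le_sum_of_squares[THEN order_trans]) (simp_all add: finite_vertices mult.commute)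
  also have "(\<Sum>v\<in>vertices H. (real (?deg v))\<^sup>2)
      = real (\<Sum>v\<in>vertices H. (?deg v)\<^sup>2)" by simp
  also have "\<dots> = (\<Sum>e\<in>edges H. \<Sum>f\<in>edges H. real (card (e \<inter> f)))"
    by (simp only: sum_degrees_squared of_nat_sum)
  finally have deg: "(real (k * num_edges H))\<^sup>2
      \<le> num_vertices H * (\<Sum>e\<in>edges H. \<Sum>f\<in>edges H. real (card (e \<inter> f)))" .
  \<comment> \<open>The factor \<open>k\<close> pays for weighting a meeting pair by
    \<open>card (e \<inter> f) \<le> k\<close> instead of by one.\<close>
  have term_ge: "?w * real (card (e \<inter> f)) \<le> k * (p ^ card (e \<union> f) - p ^ (2 * k))"
    if "e \<in> edges H" "f \<in> edges H" for e f
  proof (cases "card (e \<inter> f) = 0")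
    case True
    then show ?thesis using card_Un_edges[OF that] by simp
  next
    case False
    have "card (e \<union> f) \<le> 2 * k - 1" using False card_Un_edges[OF that] by linarith
    then have "p ^ (2 * k - 1) \<le> p ^ card (e \<union> f)" using p by (intro power_decreasing)
    moreover have "p ^ (2 * k) = p * p ^ (2 * k - 1)" using k by (simp flip: power_Suc)
    ultimately have w: "?w \<le> p ^ card (e \<union> f) - p ^ (2 * k)" by (simp add: algebra_simps)
    have "card (e \<inter> f) \<le> k"
      using card_mono[OF finite_edge[OF that(1)], of "e \<inter> f"] card_edge[OF that(1)] by simp
    then have "?w * real (card (e \<inter> f)) \<le> ?w * k" using p by (intro mult_left_mono) auto
    also have "\<dots> \<le> (p ^ card (e \<union> f) - p ^ (2 * k)) * k" using w by (intro mult_right_mono) auto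
    finally show ?thesis by (simp add: mult.commute)
  qed
  have "?w * (\<Sum>e\<in>edges H. \<Sum>f\<in>edges H. real (card (e \<inter> f))) \<le> k * ?Var"
    unfolding variance_num_edges[OF p] sum_distrib_left by (intro sum_mono term_ge)
  then have "num_vertices H * (?w * (\<Sum>e\<in>edges H. \<Sum>f\<in>edges H. real (card (e \<inter> f))))
      \<le> num_vertices H * (k * ?Var)" by (rule mult_left_mono) simp
  moreover have "?w * (real (k * num_edges H))\<^sup>2
      \<le> ?w * (num_vertices H * (\<Sum>e\<in>edges H. \<Sum>f\<in>edges H. real (card (e \<inter> f))))"
    using deg p by (intro mult_left_mono) auto
  ultimately have "real k * (?w * (k * real (num_edges H) ^ 2)) \<le> real k * (num_vertices H * ?Var)"
    by (simp add: algebra_simps power2_eq_square)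
  then show ?thesis using k by (simp only: mult_le_cancel_left_pos of_nat_0_less_iff)
qed

section \<open>Comparison of the variance with \<Lambda> in the given range of
  \<open>p\<close>\<close>

context
  fixes a D \<alpha> p :: real and n :: nat
  assumes k: "k \<ge> 2" and a: "a > 0" and D: "D \<ge> 1" and \<alpha>: "0 < \<alpha>" "\<alpha> < 1" and n: "n > 0"
    and num_vertices_le: "num_vertices H \<le> D * n" and num_edges_ge: "num_edges H \<ge> a * (real n)\<^sup>2"
    and max_codegree_le: "max_codegree H \<le> D"
    and p_ge: "\<alpha> * real n powr (- 1 / real (k - 1)) \<le> p" and p_le: "p \<le> 1 - \<alpha>"
begin

abbreviation mean :: real where
  "mean \<equiv> num_edges H * p ^ k"

abbreviation Lambda :: real where
  "Lambda \<equiv> mean * (1 + n * p ^ (k - 1))"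

lemma p_pos: "p > 0"
proof -
  have "0 < \<alpha> * real n powr (- 1 / real (k - 1))" using \<alpha> n by simp
  then show ?thesis using p_ge by linarith
qed

lemma num_edges_pos: "real (num_edges H) > 0"
  using num_edges_ge a n by (meson less_le_trans mult_pos_pos of_nat_0_less_iff zero_less_power)

lemma mean_pos: "mean > 0"
  using num_edges_pos p_pos by simp

lemma Lambda_pos: "Lambda > 0"
  using p_pos by (intro mult_pos_pos[OF mean_pos] add_pos_nonneg) auto

lemma mean_ge: "a * (real n)\<^sup>2 * p ^ k \<le> mean"
  using num_edges_ge p_pos by (intro mult_right_mono) auto

text \<open>The exponent in the lower bound on \<open>p\<close> is such that its power
  \<open>k - 1\<close> is a multiple of \<open>1 / n\<close>.\<close>

lemma power_le_scaled: "\<alpha> ^ (k - 1) \<le> n * p ^ (k - 1)"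
proof -
  have "(real n powr (- 1 / real (k - 1))) ^ (k - 1)
      = (real n powr (- 1 / real (k - 1))) powr real (k - 1)"
    using n by (intro powr_realpow[symmetric]) simp
  also have "\<dots> = real n powr (- 1 / real (k - 1) * real (k - 1))" by (rule powr_powr)
  also have "\<dots> = 1 / n" using k n by (simp add: powr_minus_divide)
  finally have "\<alpha> ^ (k - 1) / n = (\<alpha> * real n powr (- 1 / real (k - 1))) ^ (k - 1)"
    by (simp add: power_mult_distrib)
  also have "\<dots> \<le> p ^ (k - 1)" using p_ge \<alpha> by (intro power_mono) auto
  finally show ?thesis using n by (simp add: field_simps)
qed

text \<open>The summand 1 in \<Lambda> is at most a constant times \<open>n * p ^ (k - 1)\<close>,
  so \<Lambda> may be replaced by \<open>mean * (n * p ^ (k - 1))\<close> up to a constant.\<close>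

lemma Lambda_le: "Lambda \<le> mean * ((1 + 1 / \<alpha> ^ (k - 1)) * (n * p ^ (k - 1)))"
proof (rule mult_left_mono)
  have "1 \<le> n * p ^ (k - 1) / \<alpha> ^ (k - 1)" using power_le_scaled \<alpha> by (simp add: field_simps)
  then show "1 + n * p ^ (k - 1) \<le> (1 + 1 / \<alpha> ^ (k - 1)) * (n * p ^ (k - 1))"
    by (simp add: algebra_simps)
qed (use mean_pos in simp)

lemma power_split: "x ^ (2 * k - 1) = x ^ k * x ^ (k - 1)" for x :: real
  using k by (simp add: mult_2 flip: power_add)

text \<open>In the general lower bound, one factor \<open>num_edges H\<close> becomes part of the
  mean and the other is at least \<open>a * n\<^sup>2\<close>; dividing by
  \<open>num_vertices H \<le> D * n\<close> leaves \<open>mean * (n * p ^ (k - 1))\<close>, of the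
  order of \<Lambda>.\<close>

lemma variance_ge_Lambda:
  "\<alpha> * k * a / (D * (1 + 1 / \<alpha> ^ (k - 1))) * Lambda
    \<le> measure_pmf.variance (random_induced H p) (\<lambda>G. real (num_edges G))" (is "_ \<le> ?Var")
proof -
  let ?C = "1 + 1 / \<alpha> ^ (k - 1)"
  have C: "?C > 0" using \<alpha> by (simp add: add_pos_pos)
  have "n * (\<alpha> * k * a * (mean * (n * p ^ (k - 1))))
      = \<alpha> * (p ^ k * p ^ (k - 1)) * (k * (real (num_edges H) * (a * (real n)\<^sup>2)))"
    by (simp add: algebra_simps power2_eq_square)
  also have "\<dots> \<le> (1 - p) * (p ^ k * p ^ (k - 1)) * (k * (real (num_edges H) * real (num_edges H)))"
    using p_le p_pos \<alpha> a num_edges_ge num_edges_pos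
    by (intro mult_mono mult_nonneg_nonneg order_refl) auto
  also have "\<dots> = (1 - p) * p ^ (2 * k - 1) * (k * real (num_edges H) ^ 2)"
    by (simp only: power_split power2_eq_square)
  also have "\<dots> \<le> num_vertices H * ?Var"
    using k p_pos p_le \<alpha> by (intro variance_num_edges_ge) auto
  also have "\<dots> \<le> D * n * ?Var"
    using num_vertices_le by (intro mult_right_mono) simp_all
  finally have "n * (\<alpha> * k * a * (mean * (n * p ^ (k - 1)))) \<le> n * (D * ?Var)"
    by (simp add: algebra_simps)
  then have main: "\<alpha> * k * a * (mean * (n * p ^ (k - 1))) \<le> D * ?Var" using n by simp
  have "\<alpha> * k * a * Lambda \<le> \<alpha> * k * a * (mean * (?C * (n * p ^ (k - 1))))"
    using \<alpha> a by (intro mult_left_mono[OF Lambda_le]) simp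
  also have "\<dots> = ?C * (\<alpha> * k * a * (mean * (n * p ^ (k - 1))))" by simp
  also have "\<dots> \<le> ?C * (D * ?Var)" using main C by (intro mult_left_mono) simp_all
  finally have "\<alpha> * k * a * Lambda \<le> ?Var * (D * ?C)" by (simp only: mult_ac)
  moreover have "D * ?C > 0" using D C by simp
  ultimately show ?thesis by (simp only: pos_divide_le_eq times_divide_eq_left)
qed

text \<open>Passing from \<open>q\<close> to \<open>p\<close> costs at most
  \<open>2 ^ (2 * k)\<close>. The two parts of the variance bound match the two summands of
  \<Lambda>: \<open>n ^ 3 * p ^ (2 * k - 1)\<close> is \<open>n\<^sup>2 * p ^ k\<close>, at most
  \<open>mean / a\<close>, times \<open>n * p ^ (k - 1)\<close>.\<close>

lemma variance_le_Lambda: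
  assumes q: "0 \<le> q" "q \<le> 1" "q \<le> 2 * p"
  shows "measure_pmf.variance (random_induced H q) (\<lambda>G. real (num_edges G))
    \<le> 4 ^ k * (D ^ 5 / a + k\<^sup>2 * D) * Lambda"
proof -
  have q_pow: "q ^ j \<le> 4 ^ k * p ^ j" if "j \<le> 2 * k" for j
  proof -
    have "q ^ j \<le> (2 * p) ^ j" using q by (intro power_mono) auto
    also have "\<dots> = 2 ^ j * p ^ j" by (rule power_mult_distrib)
    also have "\<dots> \<le> 2 ^ (2 * k) * p ^ j"
      using that p_pos by (intro mult_right_mono power_increasing) auto
    finally show ?thesis by (simp add: power_mult)
  qed
  have "real (num_vertices H) ^ 3 * real (max_codegree H) ^ 2 * q ^ (2 * k - 1)
      \<le> (D * n) ^ 3 * D ^ 2 * (4 ^ k * p ^ (2 * k - 1))"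
    using num_vertices_le max_codegree_le q D
    by (intro mult_mono power_mono q_pow mult_nonneg_nonneg zero_le_power) auto
  also have "\<dots> = 4 ^ k * (D ^ 5 / a) * (a * (real n)\<^sup>2 * p ^ k) * (n * p ^ (k - 1))"
    unfolding power_split using a by (simp add: power_mult_distrib eval_nat_numeral field_simps)
  also have "\<dots> \<le> 4 ^ k * (D ^ 5 / a) * mean * (n * p ^ (k - 1))"
    using a D p_pos by (intro mult_right_mono mult_left_mono mean_ge) auto
  finally have one: "real (num_vertices H) ^ 3 * real (max_codegree H) ^ 2 * q ^ (2 * k - 1)
      \<le> 4 ^ k * (D ^ 5 / a) * (mean * (n * p ^ (k - 1)))" by (simp only: mult_ac)
  have "real (num_edges H) * real (k\<^sup>2 * max_codegree H) * q ^ k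
      \<le> real (num_edges H) * (k\<^sup>2 * D) * (4 ^ k * p ^ k)"
    using max_codegree_le q D by (intro mult_mono q_pow) (auto intro!: mult_left_mono)
  also have "\<dots> = 4 ^ k * (k\<^sup>2 * D) * mean" by (simp only: mult_ac)
  finally have two: "real (num_edges H) * real (k\<^sup>2 * max_codegree H) * q ^ k
      \<le> 4 ^ k * (k\<^sup>2 * D) * mean" .
  have "mean \<le> Lambda" "mean * (n * p ^ (k - 1)) \<le> Lambda"
    using mean_pos p_pos by (simp_all add: algebra_simps)
  then have "4 ^ k * (D ^ 5 / a) * (mean * (n * p ^ (k - 1))) + 4 ^ k * (k\<^sup>2 * D) * mean
      \<le> 4 ^ k * (D ^ 5 / a) * Lambda + 4 ^ k * (k\<^sup>2 * D) * Lambda"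
    using a D p_pos by (intro add_mono mult_left_mono) auto
  also have "\<dots> = 4 ^ k * (D ^ 5 / a + k\<^sup>2 * D) * Lambda" by (simp only: distrib_left distrib_right)
  finally show ?thesis
    using variance_num_edges_le[OF k q(1,2)] one two by linarith
qed

section \<open>Raising the vertex probability and returning to \<open>p\<close>\<close>

text \<open>The margin \<alpha> between \<open>p\<close> and 1 leaves room for a relative increase
  of up to \<alpha>, because \<open>(1 - \<alpha>) * (1 + \<alpha>) \<le> 1\<close>.\<close>

lemma tilt_bounds:
  assumes "0 \<le> x" "x \<le> \<alpha>"
  shows "0 \<le> p * (1 + x)" "p * (1 + x) \<le> 1"
proof -
  have "p * (1 + x) \<le> (1 - \<alpha>) * (1 + \<alpha>)"
    using p_pos p_le assms \<alpha> by (intro mult_mono) auto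
  also have "\<dots> \<le> 1" by (simp add: algebra_simps)
  finally show "p * (1 + x) \<le> 1" .
qed (use p_pos assms in simp)

text \<open>After tilting, the target lies at least \<open>K * t\<close> below the mean, and the
  second condition on \<open>K\<close> makes the variance at most half of
  \<open>(K * t)\<^sup>2\<close>, so Chebyshev's inequality applies.\<close>

lemma prob_num_edges_tilted:
  assumes K: "K \<ge> 1" "2 * (4 ^ k * (D ^ 5 / a + k\<^sup>2 * D)) \<le> K\<^sup>2 * \<epsilon>"
    and t: "t > 0" "\<epsilon> * Lambda \<le> t\<^sup>2" "K * t \<le> \<alpha> * mean"
  shows "measure_pmf.prob (random_induced H (p * (1 + K * (t / mean))))
    {G. mean + t \<le> num_edges G} \<ge> 1 / 2"
proof -
  let ?q = "p * (1 + K * (t / mean))"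
  let ?M = "random_induced H ?q"
  let ?X = "\<lambda>G::'a hypergraph. real (num_edges G)"
  let ?E = "num_edges H * ?q ^ k"
  let ?Var = "measure_pmf.variance ?M ?X"
  have x: "0 \<le> K * (t / mean)" "K * (t / mean) \<le> \<alpha>"
    using K t mean_pos by (simp_all add: field_simps)
  note q = tilt_bounds[OF x]
  have "?q \<le> p * 2" using x \<alpha> p_pos by (intro mult_left_mono) auto
  then have "?Var \<le> 4 ^ k * (D ^ 5 / a + k\<^sup>2 * D) * Lambda"
    using variance_le_Lambda[OF q] by simp
  also have "2 * \<dots> \<le> K\<^sup>2 * \<epsilon> * Lambda"
    using mult_right_mono[OF K(2) less_imp_le[OF Lambda_pos]] by (simp only: mult_ac)
  also have "\<dots> \<le> (K * t)\<^sup>2" using mult_left_mono[OF t(2), of "K\<^sup>2"] by (simp add: power_mult_distrib mult_ac)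
  finally have Var: "?Var / (K * t)\<^sup>2 \<le> 1 / 2"
    using K t by (simp add: field_simps)
  have "1 + real k * (K * (t / mean)) \<le> (1 + K * (t / mean)) ^ k"
    using x by (intro Bernoulli_inequality) linarith
  \<comment> \<open>Here \<open>k \<ge> 2\<close> doubles the gain in the mean: one
    \<open>K * t\<close> covers the required excess \<open>t\<close>, the other is the deviation
    allowed in Chebyshev's inequality.\<close>
  moreover have "2 * (K * (t / mean)) \<le> real k * (K * (t / mean))"
    using k x by (intro mult_right_mono) auto
  ultimately have "mean * (1 + 2 * (K * (t / mean))) \<le> mean * (1 + K * (t / mean)) ^ k"
    using mean_pos by (intro mult_left_mono) auto
  also have "\<dots> = ?E" by (simp add: power_mult_distrib)
  finally have "mean * (1 + 2 * (K * (t / mean))) \<le> ?E" .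
  moreover have "m * (1 + 2 * (K * (t / m))) = m + 2 * (K * t)" if "m > 0" for m
    using that by (simp add: distrib_left)
  from this[OF mean_pos] have "mean * (1 + 2 * (K * (t / mean))) = mean + 2 * (K * t)" .
  ultimately have "mean + 2 * (K * t) \<le> ?E" by simp
  moreover have "t \<le> K * t" using K t by simp
  ultimately have E: "mean + t \<le> ?E - K * t" by linarith
  have "measure_pmf.prob ?M (- {G. mean + t \<le> ?X G})
      \<le> measure_pmf.prob ?M {G \<in> space ?M. K * t \<le> \<bar>?X G - measure_pmf.expectation ?M ?X\<bar>}"
    using E unfolding expectation_num_edges[OF q]
    by (intro measure_pmf.finite_measure_mono) auto
  also have "\<dots> \<le> ?Var / (K * t)\<^sup>2"
    using K t by (intro measure_pmf.Chebyshev_inequality integrable_random_induced) auto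
  also have "\<dots> \<le> 1 / 2" by (rule Var)
  finally show ?thesis
    using measure_pmf.prob_compl[of "{G. mean + t \<le> ?X G}" ?M] by (simp add: Compl_eq_Diff_UNIV)
qed

text \<open>Of the two terms in the constant, \<open>2 / \<epsilon>\<close> absorbs the factor 1/4
  left by squaring the probability 1/2, and the other bounds the cost of returning from the tilted
  probability to \<open>p\<close>.\<close>

lemma prob_num_edges_ge:
  assumes K: "K \<ge> 1" "2 * (4 ^ k * (D ^ 5 / a + k\<^sup>2 * D)) \<le> K\<^sup>2 * \<epsilon>" and \<epsilon>: "\<epsilon> > 0"
    and t: "t > 0" "\<epsilon> * Lambda \<le> t\<^sup>2" "K * t \<le> \<alpha> * mean"
  shows "exp (- ((2 / \<epsilon> + D * (1 + 1 / \<alpha> ^ (k - 1)) * K\<^sup>2 / (\<alpha> * a)) * (t\<^sup>2 / Lambda)))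
    \<le> measure_pmf.prob (random_induced H p) {G. mean + t \<le> num_edges G}"
proof -
  let ?x = "K * (t / mean)"
  let ?q = "p * (1 + ?x)"
  let ?C = "1 + 1 / \<alpha> ^ (k - 1)"
  let ?N = "num_vertices H"
  let ?A = "{G. mean + t \<le> num_edges G}"
  let ?P = "measure_pmf.prob (random_induced H p) ?A"
  let ?R = "D * ?C * K\<^sup>2 / (\<alpha> * a) * (t\<^sup>2 / Lambda)"
  have x: "0 \<le> ?x" "?x \<le> \<alpha>"
    using K t mean_pos by (simp_all add: field_simps)
  note q = tilt_bounds[OF x]
  have p: "p < 1" using p_le \<alpha> by linarith
  have C: "?C > 0" using \<alpha> by (simp add: add_pos_pos)

  \<comment> \<open>This converts the natural scale of the cost,
    \<open>n * p * (t / mean)\<^sup>2\<close>, into \<open>t\<^sup>2 / \<Lambda>\<close>. It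
    combines \<open>Lambda_le\<close> with \<open>a * n\<^sup>2 * p ^ k \<le> mean\<close>.\<close>
  have "Lambda * (n * p) \<le> mean * (?C * (n * p ^ (k - 1))) * (n * p)"
    using p_pos by (intro mult_right_mono[OF Lambda_le]) simp
  also have "\<dots> = mean * (?C / a) * (a * (real n)\<^sup>2 * p ^ k)"
    using a k by (cases k) (simp_all add: power2_eq_square)
  also have "\<dots> \<le> mean * (?C / a) * mean"
    using C a p_pos by (intro mult_left_mono[OF mean_ge] mult_nonneg_nonneg divide_nonneg_nonneg) auto
  finally have "Lambda * (n * p) \<le> mean * (?C / a) * mean" .
  moreover have "u / m\<^sup>2 \<le> v / l" if "l * u \<le> m * v * m" "m > 0" "l > 0" for l m u v :: real
    using that by (simp add: field_simps power2_eq_square)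
  ultimately have "n * p / mean\<^sup>2 \<le> ?C / a / Lambda"
    using mean_pos Lambda_pos by blast
  then have key: "D / \<alpha> * K\<^sup>2 * t\<^sup>2 * (n * p / mean\<^sup>2) \<le> D / \<alpha> * K\<^sup>2 * t\<^sup>2 * (?C / a / Lambda)"
    using D \<alpha> by (intro mult_left_mono) auto

  \<comment> \<open>The shift is \<open>p * y\<close>, so its square cancels the \<open>p\<close> in
    the denominator and leaves one factor \<open>p\<close>.\<close>
  have "?N * (p * (1 + y) - p)\<^sup>2 / (p * (1 - p)) = ?N * p * y\<^sup>2 / (1 - p)" for y
    using p_pos p by (simp add: distrib_left power2_eq_square)
  then have "?N * (?q - p)\<^sup>2 / (p * (1 - p)) = ?N * p * ?x\<^sup>2 / (1 - p)" .
  also have "\<dots> \<le> (D * n) * p * ?x\<^sup>2 / \<alpha>"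
    using num_vertices_le p_pos p_le \<alpha> D by (intro frac_le mult_right_mono) auto
  also have "\<dots> = D / \<alpha> * K\<^sup>2 * t\<^sup>2 * (n * p / mean\<^sup>2)"
    by (simp add: power_mult_distrib power_divide mult_ac)
  also have "\<dots> \<le> D / \<alpha> * K\<^sup>2 * t\<^sup>2 * (?C / a / Lambda)" by (rule key)
  also have "\<dots> = ?R" by (simp add: mult_ac)
  finally have cost: "?N * (?q - p)\<^sup>2 / (p * (1 - p)) \<le> ?R" .

  let ?B = "induced H -` ?A"
  have "(1 / 2)\<^sup>2 \<le> (measure_pmf.prob (random_subset (vertices H) ?q) ?B)\<^sup>2"
    using prob_num_edges_tilted[OF K(1) _ t] K(2)
    by (intro power_mono) (simp_all add: random_induced_def)
  also have "\<dots> \<le> ?P * exp (?N * (?q - p)\<^sup>2 / (p * (1 - p)))"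
    using prob_random_subset_change[OF finite_vertices p_pos p q, of ?B]
    by (simp add: random_induced_def num_vertices_def)
  also have "\<dots> \<le> ?P * exp ?R"
    using cost by (intro mult_left_mono) simp_all
  finally have quarter: "1 / 4 \<le> ?P * exp ?R" by (simp add: power2_eq_square)

  \<comment> \<open>As \<open>t\<^sup>2\<close> is at least \<epsilon>\<Lambda>, the multiple
    \<open>2 / \<epsilon>\<close> of \<open>t\<^sup>2 / \<Lambda>\<close> is at least 2, and
    \<open>exp (- 2) \<le> 1 / 4\<close>.\<close>
  have "2 \<le> 2 / \<epsilon> * (t\<^sup>2 / l)" if "\<epsilon> * l \<le> t\<^sup>2" "l > 0" for l
    using that \<epsilon> by (simp add: field_simps)
  then have "2 \<le> 2 / \<epsilon> * (t\<^sup>2 / Lambda)"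
    using t(2) Lambda_pos by blast
  then have "exp (- (2 / \<epsilon> * (t\<^sup>2 / Lambda))) \<le> exp (- 2)" by (simp only: exp_le_cancel_iff neg_le_iff_le)
  also have "exp (- 2) \<le> (1 / 4 :: real)"
  proof -
    have "(2::real)\<^sup>2 \<le> (exp 1)\<^sup>2" using exp_ge_add_one_self[of 1] by (intro power_mono) auto
    then show ?thesis by (simp add: exp_minus field_simps flip: exp_double)
  qed
  finally have "exp (- (2 / \<epsilon> * (t\<^sup>2 / Lambda))) * exp (- ?R) \<le> ?P * exp ?R * exp (- ?R)"
    using quarter by (intro mult_right_mono) auto
  also have "\<dots> = ?P" by (simp add: exp_minus)
  also have "exp (- (2 / \<epsilon> * (t\<^sup>2 / Lambda))) * exp (- ?R)
      = exp (- ((2 / \<epsilon> + D * ?C * K\<^sup>2 / (\<alpha> * a)) * (t\<^sup>2 / Lambda)))"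
    unfolding exp_add[symmetric] by (simp only: distrib_right minus_add_distrib)
  finally show ?thesis .
qed

end

end

section \<open>The rate function\<close>

lemma phi_le_square:
  assumes "0 \<le> x"
  shows "phi x \<le> x\<^sup>2"
proof -
  have "(1 + x) * ln (1 + x) \<le> (1 + x) * x"
    using assms by (intro mult_left_mono ln_add_one_self_le_self) auto
  then show ?thesis by (simp add: phi_def algebra_simps power2_eq_square)
qed

text \<open>The difference vanishes at 0, and its derivative \<open>ln (1 + y) - y / 2\<close> is
  nonnegative because \<open>ln (1 + y) \<ge> y / (1 + y)\<close> and
  \<open>y \<le> 1\<close>.\<close>

lemma phi_ge_square:
  assumes "0 \<le> x" "x \<le> 1"
  shows "x\<^sup>2 / 4 \<le> phi x"
proof -
  have "phi 0 - 0\<^sup>2 / 4 \<le> phi x - x\<^sup>2 / 4"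
  proof (rule DERIV_nonneg_imp_nondecreasing[OF assms(1)])
    fix y assume y: "0 \<le> y" "y \<le> x"
    \<comment> \<open>The bound \<open>ln z \<le> z - 1\<close> is taken at the reciprocal
      \<open>z = 1 / (1 + y)\<close> to obtain a lower bound on \<open>ln (1 + y)\<close>.\<close>
    have "ln (1 / (1 + y)) \<le> 1 / (1 + y) - 1" using y by (intro ln_le_minus_one) auto
    then have "y / (1 + y) \<le> ln (1 + y)" using y by (simp add: ln_div field_simps)
    moreover have "y / 2 \<le> y / (1 + y)" using y assms by (intro divide_left_mono) auto
    ultimately have "0 \<le> ln (1 + y) - y / 2" by linarith
    moreover have "((\<lambda>y. phi y - y\<^sup>2 / 4) has_real_derivative ln (1 + y) - y / 2) (at y)"
      unfolding phi_def using y by (auto intro!: derivative_eq_intros simp: divide_simps) (simp add: algebra_simps)?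
    ultimately show "\<exists>d. ((\<lambda>y. phi y - y\<^sup>2 / 4) has_real_derivative d) (at y) \<and> 0 \<le> d" by blast
  qed
  then show ?thesis by (simp add: phi_def)
qed

section \<open>Choice of constants and the lower tail bound on the rate\<close>

theorem theorem4p5:
  fixes k :: nat and a D :: real
  assumes "k \<ge> 2" and "a > 0" and "D \<ge> 1"
  shows "\<exists>n\<^sub>0::nat. n\<^sub>0 > 0 \<and>
    (\<forall>\<alpha>::real. 0 < \<alpha> \<and> \<alpha> < 1 \<longrightarrow>
      (\<exists>\<beta> c :: real. \<beta> > 0 \<and> c > 0 \<and>
        (\<forall>(n::nat) (H :: 'a hypergraph) (p::real) (t::real).
          let X = (\<lambda>G. real (num_edges G));
              \<mu> = measure_pmf.expectation (random_induced H p) X;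
              Var = measure_pmf.variance (random_induced H p) X;
              \<Lambda> = \<mu> * (1 + real n * p ^ (k - 1))
          in
          n \<ge> n\<^sub>0 \<and>
          uniform_hypergraph k H \<and>
          real (num_vertices H) \<le> D * real n \<and>
          real (num_edges H) \<ge> a * (real n)\<^sup>2 \<and>
          real (max_codegree H) \<le> D \<and>
          \<alpha> * real n powr (- 1 / real (k - 1)) \<le> p \<and> p \<le> 1 - \<alpha> \<and>
          min (sqrt \<Lambda>) (sqrt Var) \<le> t \<and> t \<le> \<beta> * \<mu>
          \<longrightarrow>
          measure_pmf.prob (random_induced H p) {G. X G \<ge> \<mu> + t}
            \<ge> exp (- c * phi (t / \<mu>) * \<mu>\<^sup>2 / \<Lambda>) \<and>
          exp (- c * phi (t / \<mu>) * \<mu>\<^sup>2 / \<Lambda>) \<ge> exp (- c * t\<^sup>2 / \<Lambda>))))"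
proof (rule exI[of _ 1], intro conjI allI impI)
  fix \<alpha> :: real
  assume "0 < \<alpha> \<and> \<alpha> < 1"
  then have \<alpha>: "0 < \<alpha>" "\<alpha> < 1" by auto
  \<comment> \<open>\<epsilon> is chosen so that \<epsilon>\<Lambda> is at most both \<Lambda> and
    the variance; \<open>S\<close> is twice the constant of \<open>variance_le_Lambda\<close>, and
    \<open>K\<close> is large enough that \<open>S \<le> K\<^sup>2 * \<epsilon>\<close>. The
    constant of \<open>prob_num_edges_ge\<close> is then \<open>c\<close>.\<close>
  define R where "R = D * (1 + 1 / \<alpha> ^ (k - 1))"
  define \<epsilon> where "\<epsilon> = min 1 (\<alpha> * k * a / R)"
  define S where "S = 2 * (4 ^ k * (D ^ 5 / a + k\<^sup>2 * D))"
  define K where "K = max 1 (sqrt (S / \<epsilon>))"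
  define c where "c = 2 / \<epsilon> + R * K\<^sup>2 / (\<alpha> * a)"
  have R: "R > 0" unfolding R_def using \<alpha> assms by (simp add: add_pos_pos)
  then have \<epsilon>: "\<epsilon> > 0" unfolding \<epsilon>_def using \<alpha> assms by simp
  have S: "S > 0" unfolding S_def using assms by (intro mult_pos_pos add_pos_pos) auto
  have K: "K \<ge> 1" by (simp add: K_def)
  have "S / \<epsilon> = (sqrt (S / \<epsilon>))\<^sup>2" using S \<epsilon> by simp
  also have "\<dots> \<le> K\<^sup>2" using S \<epsilon> unfolding K_def by (intro power_mono) auto
  finally have SK: "S \<le> K\<^sup>2 * \<epsilon>" using \<epsilon> by (simp add: field_simps)
  have c: "c > 0" unfolding c_def using \<epsilon> R \<alpha> assms by (intro add_pos_nonneg) auto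
  show "\<exists>\<beta> c :: real. \<beta> > 0 \<and> c > 0 \<and>
    (\<forall>(n::nat) (H :: 'a hypergraph) (p::real) (t::real).
      let X = (\<lambda>G. real (num_edges G));
          \<mu> = measure_pmf.expectation (random_induced H p) X;
          Var = measure_pmf.variance (random_induced H p) X;
          \<Lambda> = \<mu> * (1 + real n * p ^ (k - 1))
      in
      n \<ge> 1 \<and>
      uniform_hypergraph k H \<and>
      real (num_vertices H) \<le> D * real n \<and>
      real (num_edges H) \<ge> a * (real n)\<^sup>2 \<and>
      real (max_codegree H) \<le> D \<and>
      \<alpha> * real n powr (- 1 / real (k - 1)) \<le> p \<and> p \<le> 1 - \<alpha> \<and>
      min (sqrt \<Lambda>) (sqrt Var) \<le> t \<and> t \<le> \<beta> * \<mu>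
      \<longrightarrow>
      measure_pmf.prob (random_induced H p) {G. X G \<ge> \<mu> + t}
        \<ge> exp (- c * phi (t / \<mu>) * \<mu>\<^sup>2 / \<Lambda>) \<and>
      exp (- c * phi (t / \<mu>) * \<mu>\<^sup>2 / \<Lambda>) \<ge> exp (- c * t\<^sup>2 / \<Lambda>))"
    unfolding Let_def
  \<comment> \<open>Taking \<open>\<alpha> / K\<close> for \<beta> ensures
    \<open>K * t \<le> \<alpha> * \<mu>\<close>, which keeps the tilted probability at most 1. The
    factor 4 makes up for the loss in \<open>phi_ge_square\<close>.\<close>
  proof (rule exI[of _ "\<alpha> / K"], rule exI[of _ "4 * c"], intro conjI allI impI; (elim conjE)?)
    fix n :: nat and H :: "'a hypergraph" and p t :: real
    let ?X = "\<lambda>G::'a hypergraph. real (num_edges G)"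
    let ?M = "random_induced H p"
    define \<mu> where "\<mu> = measure_pmf.expectation ?M ?X"
    define V where "V = measure_pmf.variance ?M ?X"
    define \<Lambda> where "\<Lambda> = \<mu> * (1 + real n * p ^ (k - 1))"
    assume n: "1 \<le> n" and H: "uniform_hypergraph k H"
      and H_n: "num_vertices H \<le> D * n" "a * (real n)\<^sup>2 \<le> num_edges H" "max_codegree H \<le> D"
      and p: "\<alpha> * real n powr (- 1 / real (k - 1)) \<le> p" "p \<le> 1 - \<alpha>"
      and t_ge: "min (sqrt (measure_pmf.expectation ?M ?X * (1 + real n * p ^ (k - 1))))
        (sqrt (measure_pmf.variance ?M ?X)) \<le> t"
      and t_le: "t \<le> \<alpha> / K * measure_pmf.expectation ?M ?X"
    have n0: "n > 0" using n by simp
    note hyps = H assms \<alpha> n0 H_n p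
    have p_bounds: "0 \<le> p" "p \<le> 1" using p_pos[OF hyps] p \<alpha> by auto
    have \<mu>: "\<mu> = num_edges H * p ^ k"
      unfolding \<mu>_def by (rule expectation_num_edges[OF H p_bounds])
    have \<mu>_pos: "\<mu> > 0" unfolding \<mu> by (rule mean_pos[OF hyps])
    have \<Lambda>_pos: "\<Lambda> > 0" unfolding \<Lambda>_def \<mu> by (rule Lambda_pos[OF hyps])
    have "\<epsilon> * \<Lambda> \<le> \<alpha> * k * a / R * \<Lambda>"
      using \<Lambda>_pos unfolding \<epsilon>_def by (intro mult_right_mono) auto
    also have "\<dots> \<le> V"
      unfolding V_def \<Lambda>_def \<mu> R_def by (rule variance_ge_Lambda[OF hyps])
    finally have "\<epsilon> * \<Lambda> \<le> V" .
    moreover have "\<epsilon> * \<Lambda> \<le> 1 * \<Lambda>" using \<Lambda>_pos unfolding \<epsilon>_def by (intro mult_right_mono) auto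
    \<comment> \<open>Whichever root attains the minimum, \<open>t\<close> is at least a constant
      times the root of \<Lambda>.\<close>
    ultimately have "sqrt (\<epsilon> * \<Lambda>) \<le> min (sqrt \<Lambda>) (sqrt V)" by simp
    also have "\<dots> \<le> t" using t_ge unfolding V_def \<Lambda>_def \<mu>_def .
    finally have sqrt_le: "sqrt (\<epsilon> * \<Lambda>) \<le> t" .
    have "\<epsilon> * \<Lambda> > 0" using \<epsilon> \<Lambda>_pos by simp
    then have t: "t > 0" "\<epsilon> * \<Lambda> \<le> t\<^sup>2"
      using sqrt_le real_sqrt_gt_zero[of "\<epsilon> * \<Lambda>"] sqrt_le_D[OF sqrt_le] by linarith+
    have Kt: "K * t \<le> \<alpha> * \<mu>" using t_le K by (simp add: \<mu>_def field_simps)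
    have "exp (- (c * (t\<^sup>2 / \<Lambda>))) \<le> measure_pmf.prob ?M {G. \<mu> + t \<le> ?X G}"
      using prob_num_edges_ge[OF hyps K SK[unfolded S_def] \<epsilon> t(1)] t(2) Kt
      unfolding \<Lambda>_def \<mu> c_def R_def by blast
    \<comment> \<open>This puts \<open>t / \<mu>\<close> in the interval where the quadratic lower
      bound on \<open>phi\<close> holds.\<close>
    moreover have "t \<le> \<mu>"
    proof -
      have "t \<le> K * t" using K t by simp
      also have "\<dots> \<le> 1 * \<mu>" using Kt \<alpha> \<mu>_pos by (meson less_imp_le mult_right_mono order_trans)
      finally show ?thesis by simp
    qed
    then have ratio: "0 \<le> t / \<mu>" "t / \<mu> \<le> 1" using t \<mu>_pos by simp_all
    have sq: "(t / \<mu>)\<^sup>2 * \<mu>\<^sup>2 = t\<^sup>2" using \<mu>_pos by (simp add: power_divide)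
    have phi_ge: "t\<^sup>2 \<le> 4 * (phi (t / \<mu>) * \<mu>\<^sup>2)"
      using mult_right_mono[OF phi_ge_square[OF ratio], of "\<mu>\<^sup>2"] sq by simp
    have "exp (- (4 * c) * phi (t / \<mu>) * \<mu>\<^sup>2 / \<Lambda>) \<le> exp (- (c * (t\<^sup>2 / \<Lambda>)))"
      using mult_left_mono[OF phi_ge, of "c / \<Lambda>"] c \<Lambda>_pos by (simp add: mult_ac)
    ultimately show "exp (- (4 * c) * phi (t / measure_pmf.expectation ?M ?X)
          * (measure_pmf.expectation ?M ?X)\<^sup>2
          / (measure_pmf.expectation ?M ?X * (1 + real n * p ^ (k - 1))))
        \<le> measure_pmf.prob ?M {G. measure_pmf.expectation ?M ?X + t \<le> ?X G}"
      unfolding \<mu>_def[symmetric] \<Lambda>_def[symmetric] by linarith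
    have phi_le: "phi (t / \<mu>) * \<mu>\<^sup>2 \<le> t\<^sup>2"
      using mult_right_mono[OF phi_le_square[OF ratio(1)], of "\<mu>\<^sup>2"] sq by simp
    have "exp (- (4 * c) * t\<^sup>2 / \<Lambda>) \<le> exp (- (4 * c) * phi (t / \<mu>) * \<mu>\<^sup>2 / \<Lambda>)"
      using mult_left_mono[OF phi_le, of "4 * c / \<Lambda>"] c \<Lambda>_pos by (simp add: mult_ac)
    then show "exp (- (4 * c) * t\<^sup>2 / (measure_pmf.expectation ?M ?X * (1 + real n * p ^ (k - 1))))
        \<le> exp (- (4 * c) * phi (t / measure_pmf.expectation ?M ?X)
          * (measure_pmf.expectation ?M ?X)\<^sup>2
          / (measure_pmf.expectation ?M ?X * (1 + real n * p ^ (k - 1))))"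
      unfolding \<mu>_def[symmetric] \<Lambda>_def[symmetric] .
  qed (use \<alpha> K c in auto)
qed simp

end
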